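(* Let $k\ge1$ and let $G$ be a (simple) graph on $2k$ vertices such that every complete subgraph of $G$ has at most $k$ vertices. Then $G$ contains at least $\left[\frac{k+1}{2}\right]$ pairwise disjoint pairs of non-adjacent vertices. Moreover this bound is sharp: there exist such graphs in which every maximal-cardinality set of pairwise disjoint pairs of non-adjacent vertices has exactly $\left[\frac{k+1}{2}\right]$ elements.
   Context: $[x]$ denotes the integer part of $x$. Two pairs of vertices are disjoint if they share no vertex; a pair is non-adjacent (disconnected) if not joined by an edge. *)

theory Defs
  imports "Graph_Theory.Graph_Theory"
begin

text \<open>
  A finite simple graph is a \<^const>\<open>pair_graph\<close>: a finite, loop-free, symmetric relation
  \<^const>\<open>parcs\<close> on \<^const>\<open>pverts\<close>, each edge being present in both orientations.
\<close>

definition complete_subgraphs_bounded :: "'a pair_pre_digraph \<Rightarrow> nat \<Rightarrow> bool" where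
  "complete_subgraphs_bounded G k \<longleftrightarrow>
     (\<forall>H :: 'a pair_pre_digraph. \<forall>m.
        subgraph (with_proj H) (with_proj G) \<and> complete_digraph m (with_proj H) \<longrightarrow> m \<le> k)"

definition nonadjacent_pairs :: "'a pair_pre_digraph \<Rightarrow> 'a set set" where
  "nonadjacent_pairs G =
     {{u, v} | u v. u \<in> pverts G \<and> v \<in> pverts G \<and> u \<noteq> v \<and> (u, v) \<notin> parcs G}"

definition disjoint_nonadjacent_pairs :: "'a pair_pre_digraph \<Rightarrow> 'a set set \<Rightarrow> bool" where
  "disjoint_nonadjacent_pairs G M \<longleftrightarrow> M \<subseteq> nonadjacent_pairs G \<and> pairwise disjnt M"

end

theory Submission
  imports Defs
begin

text \<open>
  The vertices missed by a maximal set of \<open>m\<close> disjoint non-adjacent pairs form a clique, so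
  \<open>2 * k - 2 * m \<le> k\<close>. For sharpness join an independent set of \<open>k + 1\<close> vertices completely to a
  clique of \<open>k - 1\<close> further vertices: a clique of this graph contains at most one of the \<open>k + 1\<close>
  independent vertices, and all non-adjacent pairs lie among them.
\<close>

definition clique :: "'a pair_pre_digraph \<Rightarrow> 'a set \<Rightarrow> bool" where
  "clique G U \<longleftrightarrow> U \<subseteq> pverts G \<and> pairwise (\<lambda>u v. (u, v) \<in> parcs G) U"

lemma clique_verts_complete_subgraph:
  assumes "subgraph (with_proj H) (with_proj G)" "complete_digraph m (with_proj H)"
  shows "clique G (pverts H)"
  using assms by (auto simp: clique_def pairwise_def subgraph_def complete_digraph_def)

lemma (in pair_fin_digraph) clique_imp_complete_subgraph:
  assumes "clique G U"
  obtains H where "pverts H = U" "subgraph (with_proj H) (with_proj G)"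
    "complete_digraph (card U) (with_proj H)"
proof
  define H where "H = \<lparr>pverts = U, parcs = {(u, v). (u, v) \<in> U \<times> U \<and> u \<noteq> v}\<rparr>"
  show "pverts H = U" by (simp add: H_def)
  have "finite U" using assms pair_finite_verts by (auto simp: clique_def intro: finite_subset)
  then show "complete_digraph (card U) (with_proj H)"
    by (auto simp: complete_digraph_pair_def H_def)
  have "wf_digraph (with_proj H)" by unfold_locales (auto simp: H_def)
  then show "subgraph (with_proj H) (with_proj G)"
    using assms wf_digraph_axioms
    by (auto simp: subgraph_def compatible_def H_def clique_def pairwise_def)
qed

lemma (in pair_fin_digraph) complete_subgraphs_bounded_iff_card_clique_le:
  "complete_subgraphs_bounded G k \<longleftrightarrow> (\<forall>U. clique G U \<longrightarrow> card U \<le> k)"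
proof
  assume "complete_subgraphs_bounded G k"
  then show "\<forall>U. clique G U \<longrightarrow> card U \<le> k"
    unfolding complete_subgraphs_bounded_def by (metis clique_imp_complete_subgraph)
next
  assume "\<forall>U. clique G U \<longrightarrow> card U \<le> k"
  then have "card (pverts H) \<le> k"
    if "subgraph (with_proj H) (with_proj G)" "complete_digraph m (with_proj H)" for H m
    using clique_verts_complete_subgraph[OF that] by blast
  then show "complete_subgraphs_bounded G k"
    by (auto simp: complete_subgraphs_bounded_def complete_digraph_def)
qed

lemma nonadjacent_pairs_subset_Pow: "nonadjacent_pairs G \<subseteq> Pow (pverts G)"
  by (auto simp: nonadjacent_pairs_def)

lemma card_nonadjacent_pair: "P \<in> nonadjacent_pairs G \<Longrightarrow> card P = 2"
  by (auto simp: nonadjacent_pairs_def)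

lemma Union_disjoint_nonadjacent_pairs_subset:
  "disjoint_nonadjacent_pairs G M \<Longrightarrow> \<Union>M \<subseteq> pverts G"
  using nonadjacent_pairs_subset_Pow by (fastforce simp: disjoint_nonadjacent_pairs_def)

lemma card_Union_disjoint_nonadjacent_pairs:
  assumes "disjoint_nonadjacent_pairs G M"
  shows "card (\<Union>M) = 2 * card M"
proof -
  have card_2: "card P = 2" if "P \<in> M" for P
    using assms that card_nonadjacent_pair by (auto simp: disjoint_nonadjacent_pairs_def)
  have "card (\<Union>M) = (\<Sum>P\<in>M. card P)"
    using assms card_2
    by (intro card_Union_disjoint) (auto simp: disjoint_nonadjacent_pairs_def intro: card_ge_0_finite)
  also have "\<dots> = 2 * card M" using card_2 by simp
  finally show ?thesis .
qed

lemma disjoint_nonadjacent_pairs_insert: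
  assumes "disjoint_nonadjacent_pairs G M"
    and "u \<in> pverts G - \<Union>M" "v \<in> pverts G - \<Union>M" "u \<noteq> v" "(u, v) \<notin> parcs G"
  shows "disjoint_nonadjacent_pairs G (insert {u, v} M)"
  using assms
  by (auto simp: disjoint_nonadjacent_pairs_def nonadjacent_pairs_def pairwise_insert disjnt_def)

lemma clique_uncovered_by_maximal_pairs:
  assumes "disjoint_nonadjacent_pairs G M"
    and maximal: "\<And>N. disjoint_nonadjacent_pairs G N \<Longrightarrow> M \<subseteq> N \<Longrightarrow> M = N"
  shows "clique G (pverts G - \<Union>M)"
  unfolding clique_def
proof (intro conjI pairwiseI)
  fix u v
  assume uncovered: "u \<in> pverts G - \<Union>M" "v \<in> pverts G - \<Union>M" and "u \<noteq> v"
  show "(u, v) \<in> parcs G"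
  proof (rule ccontr)
    assume "(u, v) \<notin> parcs G"
    then have "M = insert {u, v} M"
      using disjoint_nonadjacent_pairs_insert[OF assms(1) uncovered \<open>u \<noteq> v\<close>] maximal by blast
    then show False using uncovered by blast
  qed
qed simp

lemma (in pair_fin_digraph) obtain_maximal_disjoint_nonadjacent_pairs:
  obtains M where "disjoint_nonadjacent_pairs G M"
    and "\<And>N. disjoint_nonadjacent_pairs G N \<Longrightarrow> M \<subseteq> N \<Longrightarrow> M = N"
proof -
  have "finite (nonadjacent_pairs G)"
    using nonadjacent_pairs_subset_Pow pair_finite_verts by (blast intro: finite_subset)
  then have "finite {M. disjoint_nonadjacent_pairs G M}"
    by (auto simp: disjoint_nonadjacent_pairs_def)
  moreover have "disjoint_nonadjacent_pairs G {}" by (simp add: disjoint_nonadjacent_pairs_def)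
  ultimately show ?thesis
    using finite_has_maximal[of "{M. disjoint_nonadjacent_pairs G M}"] that by auto
qed

lemma (in pair_fin_digraph) ex_disjoint_nonadjacent_pairs_card_ge:
  assumes "complete_subgraphs_bounded G k"
  shows "\<exists>M. disjoint_nonadjacent_pairs G M \<and> card (pverts G) \<le> k + 2 * card M"
proof -
  obtain M where M: "disjoint_nonadjacent_pairs G M"
    and maximal: "\<And>N. disjoint_nonadjacent_pairs G N \<Longrightarrow> M \<subseteq> N \<Longrightarrow> M = N"
    using obtain_maximal_disjoint_nonadjacent_pairs by blast
  have "card (pverts G) - card (\<Union>M) \<le> card (pverts G - \<Union>M)"
    using Union_disjoint_nonadjacent_pairs_subset[OF M] pair_finite_verts
    by (intro diff_card_le_card_Diff) (rule finite_subset)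
  also have "\<dots> \<le> k"
    using clique_uncovered_by_maximal_pairs[OF M maximal] assms
    by (simp add: complete_subgraphs_bounded_iff_card_clique_le)
  finally show ?thesis using M card_Union_disjoint_nonadjacent_pairs[OF M] by auto
qed

definition complete_split_graph :: "'a set \<Rightarrow> 'a set \<Rightarrow> 'a pair_pre_digraph" where
  "complete_split_graph I C = \<lparr>pverts = I \<union> C, parcs = (I \<union> C) \<times> (I \<union> C) - I \<times> I - Id\<rparr>"

lemma pverts_complete_split_graph [simp]: "pverts (complete_split_graph I C) = I \<union> C"
  by (simp add: complete_split_graph_def)

lemma parcs_complete_split_graph [simp]:
  "parcs (complete_split_graph I C) = (I \<union> C) \<times> (I \<union> C) - I \<times> I - Id"
  by (simp add: complete_split_graph_def)

lemma pair_graph_complete_split_graph: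
  assumes "finite I" "finite C"
  shows "pair_graph (complete_split_graph I C)"
  using assms by unfold_locales (auto simp: symmetric_def sym_def)

lemma card_clique_complete_split_graph_le:
  assumes "finite C" "clique (complete_split_graph I C) U"
  shows "card U \<le> card C + 1"
proof -
  have subset: "U \<subseteq> I \<union> C" and adjacent: "pairwise (\<lambda>u v. u \<notin> I \<or> v \<notin> I) U"
    using assms(2) by (auto simp: clique_def pairwise_def)
  have "card U \<le> card (U \<inter> I) + card (U - I)"
    using card_Un_le[of "U \<inter> I" "U - I"] by (simp add: Int_Diff_Un)
  moreover have "card (U \<inter> I) \<le> 1"
    using adjacent by (cases "finite (U \<inter> I)") (auto simp: pairwise_def card_le_Suc0_iff_eq)
  moreover have "card (U - I) \<le> card C" using subset assms(1) by (intro card_mono) auto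
  ultimately show ?thesis by linarith
qed

lemma complete_subgraphs_bounded_complete_split_graph:
  assumes "finite I" "finite C"
  shows "complete_subgraphs_bounded (complete_split_graph I C) (card C + 1)"
proof -
  interpret pair_graph "complete_split_graph I C"
    using assms by (rule pair_graph_complete_split_graph)
  show ?thesis
    using card_clique_complete_split_graph_le[OF assms(2)]
    by (simp add: complete_subgraphs_bounded_iff_card_clique_le)
qed

lemma card_disjoint_nonadjacent_pairs_complete_split_graph_le:
  assumes "finite I" "disjoint_nonadjacent_pairs (complete_split_graph I C) M"
  shows "card M \<le> card I div 2"
proof -
  have "\<Union>M \<subseteq> I"
    using assms(2) by (fastforce simp: disjoint_nonadjacent_pairs_def nonadjacent_pairs_def)
  then have "card (\<Union>M) \<le> card I" using assms(1) by (intro card_mono)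
  then show ?thesis using card_Union_disjoint_nonadjacent_pairs[OF assms(2)] by linarith
qed

lemma card_maximum_disjoint_nonadjacent_pairs_complete_split_graph:
  assumes "finite I" "finite C" "I \<inter> C = {}"
    and maximum: "is_arg_max card (disjoint_nonadjacent_pairs (complete_split_graph I C)) M"
  shows "card M = card I div 2"
proof (rule antisym)
  interpret pair_graph "complete_split_graph I C"
    using assms(1,2) by (rule pair_graph_complete_split_graph)
  show "card M \<le> card I div 2"
    using maximum card_disjoint_nonadjacent_pairs_complete_split_graph_le[OF assms(1)]
    by (auto simp: is_arg_max_def)
  obtain N where N: "disjoint_nonadjacent_pairs (complete_split_graph I C) N"
    and "card (I \<union> C) \<le> card C + 1 + 2 * card N"
    using ex_disjoint_nonadjacent_pairs_card_ge
      [OF complete_subgraphs_bounded_complete_split_graph[OF assms(1,2)]] by auto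
  then have "card I div 2 \<le> card N" using assms(1-3) by (simp add: card_Un_disjoint)
  also have "card N \<le> card M" using maximum N by (simp add: is_arg_max_linorder)
  finally show "card I div 2 \<le> card M" .
qed

theorem lemma3p1:
  fixes k :: nat
  assumes "k \<ge> 1"
  shows "(\<forall>G :: 'a pair_pre_digraph.
            pair_graph G \<and> card (pverts G) = 2 * k \<and> complete_subgraphs_bounded G k \<longrightarrow>
            (\<exists>M. disjoint_nonadjacent_pairs G M \<and> card M \<ge> (k + 1) div 2))
       \<and> (\<exists>G :: nat pair_pre_digraph.
            pair_graph G \<and> card (pverts G) = 2 * k \<and> complete_subgraphs_bounded G k \<and>
            (\<forall>M. is_arg_max card (disjoint_nonadjacent_pairs G) M \<longrightarrow> card M = (k + 1) div 2))"
proof (intro conjI allI impI, elim conjE)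
  fix G :: "'a pair_pre_digraph"
  assume "pair_graph G" and card: "card (pverts G) = 2 * k"
    and bounded: "complete_subgraphs_bounded G k"
  interpret pair_graph G by fact
  obtain M where "disjoint_nonadjacent_pairs G M" "2 * k \<le> k + 2 * card M"
    using ex_disjoint_nonadjacent_pairs_card_ge[OF bounded] card by auto
  then show "\<exists>M. disjoint_nonadjacent_pairs G M \<and> card M \<ge> (k + 1) div 2"
    by (intro exI[of _ M]) auto
next
  define I C where "I = {..k}" and "C = {k<..<2 * k}"
  have finite: "finite I" "finite C" and disjoint: "I \<inter> C = {}"
    and card_I: "card I = k + 1" and card_C: "card C + 1 = k"
    using assms by (auto simp: I_def C_def)
  have "card (pverts (complete_split_graph I C)) = 2 * k"
    using card_I card_C by (simp add: card_Un_disjoint[OF finite disjoint])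
  then show "\<exists>G :: nat pair_pre_digraph.
      pair_graph G \<and> card (pverts G) = 2 * k \<and> complete_subgraphs_bounded G k \<and>
      (\<forall>M. is_arg_max card (disjoint_nonadjacent_pairs G) M \<longrightarrow> card M = (k + 1) div 2)"
    using pair_graph_complete_split_graph[OF finite]
      complete_subgraphs_bounded_complete_split_graph[OF finite, unfolded card_C]
      card_maximum_disjoint_nonadjacent_pairs_complete_split_graph[OF finite disjoint]
    unfolding card_I by blast
qed

end
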